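(* Let $N=\{u_1,\dots,u_n\}$ be a finite ground set whose elements arrive in a stream in the order $u_1,\dots,u_n$, and let $f:2^N\to\mathbb{R}_{\ge 0}$ be a non-negative (not necessarily monotone) submodular function accessed through a value oracle. Consider a standardized $d$-knapsack constraint with capacity $b$ and costs $c_{i,j}$, let $\mathrm{OPT}=\max\{f(S): S\subseteq N \text{ feasible}\}$, and let $\epsilon>0$. Suppose the input $m$ satisfies $m=\max_{1\le i\le d,\,1\le j\le n} f(\{u_j\})/c_{i,j}$. Then the algorithm $\mathcal{B}_2(m)$ described in the context (with the unconstrained subroutine being a deterministic $1/2$-approximation algorithm for unconstrained non-negative submodular maximization) satisfies: (i) it outputs a feasible set $S$ (i.e. $\sum_{u_j\in S}c_{i,j}\le b$ for all $1\le i\le d$) with $f(S)\ge (\frac{1}{4(d+1)}-\epsilon)\mathrm{OPT}$; (ii) it makes 1 pass over the data set, stores at most $O(\frac{b\log b}{\epsilon})$ elements, and has $O(\frac{\log b}{\epsilon})$ query complexity per element.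
   Context: Notation: $f(u\mid T)=f(T\cup\{u\})-f(T)$. Submodularity: $f(S)+f(T)\ge f(S\cup T)+f(S\cap T)$ for all $S,T\subseteq N$. Standardized $d$-knapsack: there is a common capacity $b>0$ and costs $c_{i,j}$ with $1\le c_{i,j}\le b$ for all $1\le i\le d$, $1\le j\le n$; a set $S\subseteq N$ is feasible iff $\sum_{u_j\in S} c_{i,j}\le b$ for every $1\le i\le d$. Unconstrained subroutine: $\mathrm{Unconstrained}(A)$ is a deterministic algorithm that, given $A\subseteq N$, returns a set $T\subseteq A$ with $f(T)\ge \frac12\max_{T'\subseteq A} f(T')$. Algorithm $\mathcal{B}_2(m)$: let $Q=\{(1+\epsilon)^i: i\in\mathbb{Z},\ m/(1+\epsilon)\le (1+\epsilon)^i\le bm\}$ and for each $v\in Q$ initialize $S_1^v=S_2^v=S^v=\emptyset$. For $j=1,\dots,n$, when $u_j$ arrives, for each $v\in Q$ with $\tau=\frac{v}{4(d+1)}$: if there is some $1\le i\le d$ with $c_{i,j}\ge b/2$ and $f(\{u_j\})/c_{i,j}\ge 2\tau/b$, set $S^v=\{u_j\}$; else if $f(u_j\mid S_1^v)/c_{i,j}\ge 2\tau/b$ and $\sum_{u_l\in S_1^v\cup\{u_j\}}c_{i,l}\le b$ for all $1\le i\le d$, add $u_j$ to $S_1^v$; else if the same conditions hold with $S_2^v$ in place of $S_1^v$, add $u_j$ to $S_2^v$. After the stream ends, for each $v\in Q$ set $S_3^v=\mathrm{Unconstrained}(S_1^v)$, and return the set $S$ of largest $f$-value among all $S_1^v,S_2^v,S_3^v,S^v$,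 $v\in Q$. *)

theory Defs
  imports Complex_Main "HOL-Library.Landau_Symbols"
begin

text \<open>
  The ground set is \<open>{1..n}\<close>: the element \<open>u\<^sub>j\<close> is represented by its index \<open>j\<close>.
  Only the values of \<open>f\<close> on subsets of \<open>{1..n}\<close> are constrained.
\<close>

definition submodular_on :: "nat set \<Rightarrow> (nat set \<Rightarrow> real) \<Rightarrow> bool" where
  "submodular_on N f \<longleftrightarrow>
     (\<forall>S T. S \<subseteq> N \<longrightarrow> T \<subseteq> N \<longrightarrow> f S + f T \<ge> f (S \<union> T) + f (S \<inter> T))"

definition standardized_knapsack :: "nat \<Rightarrow> nat \<Rightarrow> real \<Rightarrow> (nat \<Rightarrow> nat \<Rightarrow> real) \<Rightarrow> bool" where
  "standardized_knapsack n d b c \<longleftrightarrow>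
     b > 0 \<and> (\<forall>i\<in>{1..d}. \<forall>j\<in>{1..n}. 1 \<le> c i j \<and> c i j \<le> b)"

definition feasible :: "nat \<Rightarrow> real \<Rightarrow> (nat \<Rightarrow> nat \<Rightarrow> real) \<Rightarrow> nat set \<Rightarrow> bool" where
  "feasible d b c S \<longleftrightarrow> (\<forall>i\<in>{1..d}. (\<Sum>j\<in>S. c i j) \<le> b)"

definition OPT :: "nat \<Rightarrow> nat \<Rightarrow> real \<Rightarrow> (nat \<Rightarrow> nat \<Rightarrow> real) \<Rightarrow> (nat set \<Rightarrow> real) \<Rightarrow> real" where
  "OPT n d b c f = Max (f ` {S. S \<subseteq> {1..n} \<and> feasible d b c S})"

definition unconstrained_half_approx ::
    "nat set \<Rightarrow> (nat set \<Rightarrow> real) \<Rightarrow> (nat set \<Rightarrow> nat set) \<Rightarrow> bool" where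
  "unconstrained_half_approx N f U \<longleftrightarrow>
     (\<forall>A. A \<subseteq> N \<longrightarrow> U A \<subseteq> A \<and> f (U A) \<ge> 1/2 * Max (f ` Pow A))"


section \<open>Computations with a value oracle and an unconstrained subroutine\<close>

text \<open>
  A computation reaches \<open>f\<close> only through \<open>Query\<close>, and the unconstrained subroutine only
  through \<open>Call\<close>. The subroutine is a black box: the queries it makes internally are not
  part of the count.
\<close>

datatype 'r oprog =
    Return 'r
  | Query "nat set" "real \<Rightarrow> 'r oprog"
  | Call "nat set" "nat set \<Rightarrow> 'r oprog"

primrec bind_prog :: "'a oprog \<Rightarrow> ('a \<Rightarrow> 'b oprog) \<Rightarrow> 'b oprog" where
  "bind_prog (Return r) k = k r"
| "bind_prog (Query S g) k = Query S (\<lambda>x. bind_prog (g x) k)"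
| "bind_prog (Call A g) k = Call A (\<lambda>T. bind_prog (g T) k)"

primrec traverse :: "('a \<Rightarrow> 'b oprog) \<Rightarrow> 'a list \<Rightarrow> 'b list oprog" where
  "traverse g [] = Return []"
| "traverse g (x # xs) =
     bind_prog (g x) (\<lambda>y. bind_prog (traverse g xs) (\<lambda>ys. Return (y # ys)))"

primrec run :: "(nat set \<Rightarrow> real) \<Rightarrow> (nat set \<Rightarrow> nat set) \<Rightarrow> 'r oprog \<Rightarrow> 'r" where
  "run f U (Return r) = r"
| "run f U (Query S g) = run f U (g (f S))"
| "run f U (Call A g) = run f U (g (U A))"

primrec num_queries :: "(nat set \<Rightarrow> real) \<Rightarrow> (nat set \<Rightarrow> nat set) \<Rightarrow> 'r oprog \<Rightarrow> nat" where
  "num_queries f U (Return r) = 0"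
| "num_queries f U (Query S g) = Suc (num_queries f U (g (f S)))"
| "num_queries f U (Call A g) = num_queries f U (g (U A))"


section \<open>Streaming algorithms\<close>

text \<open>
  Each entry of \<open>passes\<close> is the update performed on every arrival during one scan of the
  stream; \<open>finish\<close> is run afterwards and yields the final memory together with the output;
  \<open>stored\<close> is the number of ground-set elements held in a memory state.
\<close>

record 's streaming_alg =
  init :: 's
  passes :: "(nat \<Rightarrow> 's \<Rightarrow> 's oprog) list"
  finish :: "'s \<Rightarrow> ('s \<times> nat set) oprog"
  stored :: "'s \<Rightarrow> nat"

definition num_passes :: "'s streaming_alg \<Rightarrow> nat" where
  "num_passes A = length (passes A)"

definition scan ::
    "(nat set \<Rightarrow> real) \<Rightarrow> (nat set \<Rightarrow> nat set) \<Rightarrow> nat list \<Rightarrow>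
     (nat \<Rightarrow> 's \<Rightarrow> 's oprog) \<Rightarrow> 's \<Rightarrow> 's" where
  "scan f U us step s = fold (\<lambda>u t. run f U (step u t)) us s"

definition end_state ::
    "(nat set \<Rightarrow> real) \<Rightarrow> (nat set \<Rightarrow> nat set) \<Rightarrow> nat list \<Rightarrow> 's streaming_alg \<Rightarrow> 's" where
  "end_state f U us A = fold (scan f U us) (passes A) (init A)"

text \<open>The memory in pass \<open>p\<close> (counted from 0) after the first \<open>k\<close> arrivals of that pass.\<close>

definition state_at ::
    "(nat set \<Rightarrow> real) \<Rightarrow> (nat set \<Rightarrow> nat set) \<Rightarrow> nat list \<Rightarrow> 's streaming_alg \<Rightarrow>
     nat \<Rightarrow> nat \<Rightarrow> 's" where
  "state_at f U us A p k =
     scan f U (take k us) (passes A ! p) (fold (scan f U us) (take p (passes A)) (init A))"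

definition result ::
    "(nat set \<Rightarrow> real) \<Rightarrow> (nat set \<Rightarrow> nat set) \<Rightarrow> nat list \<Rightarrow> 's streaming_alg \<Rightarrow>
     's \<times> nat set" where
  "result f U us A = run f U (finish A (end_state f U us A))"

definition output_set ::
    "(nat set \<Rightarrow> real) \<Rightarrow> (nat set \<Rightarrow> nat set) \<Rightarrow> nat list \<Rightarrow> 's streaming_alg \<Rightarrow> nat set" where
  "output_set f U us A = snd (result f U us A)"

text \<open>The successor accounts for the arriving element while it is being processed.\<close>

definition peak_storage ::
    "(nat set \<Rightarrow> real) \<Rightarrow> (nat set \<Rightarrow> nat set) \<Rightarrow> nat list \<Rightarrow> 's streaming_alg \<Rightarrow> nat" where
  "peak_storage f U us A =
     Suc (Max (stored A `
       ({state_at f U us A p k | p k. p < num_passes A \<and> k \<le> length us}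
        \<union> {fst (result f U us A)})))"

definition element_queries ::
    "(nat set \<Rightarrow> real) \<Rightarrow> (nat set \<Rightarrow> nat set) \<Rightarrow> nat list \<Rightarrow> 's streaming_alg \<Rightarrow> nat \<Rightarrow> nat" where
  "element_queries f U us A k =
     (\<Sum>p<num_passes A. num_queries f U ((passes A ! p) (us ! k) (state_at f U us A p k)))"

definition finish_queries ::
    "(nat set \<Rightarrow> real) \<Rightarrow> (nat set \<Rightarrow> nat set) \<Rightarrow> nat list \<Rightarrow> 's streaming_alg \<Rightarrow> nat" where
  "finish_queries f U us A = num_queries f U (finish A (end_state f U us A))"


section \<open>The algorithm\<close>

text \<open>
  One \<open>slot\<close> per guess \<open>v\<close>: the fields \<open>S1\<close>, \<open>S2\<close>, \<open>S3\<close> are \<open>S\<^sub>1\<^sup>v\<close>, \<open>S\<^sub>2\<^sup>v\<close>, \<open>S\<^sub>3\<^sup>v\<close>, and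
  \<open>S0\<close> is the set \<open>S\<^sup>v\<close> without a subscript.
\<close>

record slot =
  guess :: real
  S0 :: "nat set"
  S1 :: "nat set"
  S2 :: "nat set"
  S3 :: "nat set"

definition guesses :: "real \<Rightarrow> real \<Rightarrow> real \<Rightarrow> real set" where
  "guesses b \<epsilon> m = {(1 + \<epsilon>) powi i | i :: int.
     m / (1 + \<epsilon>) \<le> (1 + \<epsilon>) powi i \<and> (1 + \<epsilon>) powi i \<le> b * m}"

definition admits ::
    "nat \<Rightarrow> real \<Rightarrow> (nat \<Rightarrow> nat \<Rightarrow> real) \<Rightarrow> real \<Rightarrow> nat \<Rightarrow> nat set \<Rightarrow> real \<Rightarrow> bool" where
  "admits d b c \<tau> j S gain \<longleftrightarrow>
     (\<forall>i\<in>{1..d}. gain / c i j \<ge> 2 * \<tau> / b \<and> (\<Sum>l\<in>S \<union> {j}. c i l) \<le> b)"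

definition update_slot ::
    "nat \<Rightarrow> real \<Rightarrow> (nat \<Rightarrow> nat \<Rightarrow> real) \<Rightarrow> nat \<Rightarrow> slot \<Rightarrow> slot oprog" where
  "update_slot d b c j s =
     (let \<tau> = guess s / (4 * (real d + 1)) in
      Query {j} (\<lambda>x.
        if \<exists>i\<in>{1..d}. c i j \<ge> b / 2 \<and> x / c i j \<ge> 2 * \<tau> / b
        then Return (s\<lparr>S0 := {j}\<rparr>)
        else Query (S1 s \<union> {j}) (\<lambda>x1. Query (S1 s) (\<lambda>y1.
          if admits d b c \<tau> j (S1 s) (x1 - y1)
          then Return (s\<lparr>S1 := S1 s \<union> {j}\<rparr>)
          else Query (S2 s \<union> {j}) (\<lambda>x2. Query (S2 s) (\<lambda>y2.
            if admits d b c \<tau> j (S2 s) (x2 - y2)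
            then Return (s\<lparr>S2 := S2 s \<union> {j}\<rparr>)
            else Return s))))))"

primrec largest_from :: "nat set \<Rightarrow> real \<Rightarrow> nat set list \<Rightarrow> nat set oprog" where
  "largest_from S x [] = Return S"
| "largest_from S x (T # Ts) =
     Query T (\<lambda>y. if y > x then largest_from T y Ts else largest_from S x Ts)"

text \<open>
  With no guesses at all, which happens exactly when \<open>m = 0\<close> (if \<open>b \<ge> 1\<close>, \<open>\<epsilon> > 0\<close>,
  \<open>m \<ge> 0\<close>), there are no candidates and the empty set is returned.
\<close>

fun largest :: "nat set list \<Rightarrow> nat set oprog" where
  "largest [] = Return {}"
| "largest (S # Ss) = Query S (\<lambda>x. largest_from S x Ss)"

definition B2 ::
    "nat \<Rightarrow> real \<Rightarrow> (nat \<Rightarrow> nat \<Rightarrow> real) \<Rightarrow> real \<Rightarrow> real \<Rightarrow> slot list streaming_alg" where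
  "B2 d b c \<epsilon> m =
     \<lparr>init = map (\<lambda>v. \<lparr>guess = v, S0 = {}, S1 = {}, S2 = {}, S3 = {}\<rparr>)
               (sorted_list_of_set (guesses b \<epsilon> m)),
      passes = [\<lambda>j. traverse (update_slot d b c j)],
      finish = (\<lambda>slots.
        bind_prog (traverse (\<lambda>s. Call (S1 s) (\<lambda>T. Return (s\<lparr>S3 := T\<rparr>))) slots) (\<lambda>slots'.
        bind_prog (largest (concat (map (\<lambda>s. [S1 s, S2 s, S3 s, S0 s]) slots'))) (\<lambda>S.
        Return (slots', S)))),
      stored = (\<lambda>slots. \<Sum>s\<leftarrow>slots. card (S0 s) + card (S1 s) + card (S2 s) + card (S3 s))\<rparr>"

end

theory Submission
  imports Defs
begin

text \<open>
  If \<open>{}\<close> is optimal, it suffices that \<open>f S1\<close> never decreases. Otherwise some guess \<open>v\<close> satisfies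
  \<open>v \<le> OPT \<le> (1 + \<epsilon>) v\<close>, so it suffices that its slot contains a set of value at least \<open>\<tau> = v / (4 (d + 1))\<close>. A big element has value at least \<open>\<tau>\<close> by itself. If there
  is none and some dense enough element overflows \<open>S1\<close> or \<open>S2\<close> in a dimension, that set
  fills more than half of the capacity at density at least \<open>2 \<tau> / b\<close>, hence has value at least \<open>\<tau>\<close>. Otherwise every
  element of an optimal set \<open>X\<close> outside \<open>S1\<close> was rejected by \<open>S1\<close> for its density in some
  dimension, so adding \<open>X\<close> to \<open>S1\<close> gains at most \<open>2 \<tau> d\<close>; likewise for adding \<open>X - S1\<close> to \<open>S2\<close>.
  As \<open>S1\<close> and \<open>S2\<close> are disjoint, submodularity gives
  \<open>f X \<le> f (S1 \<union> X) + f (S2 \<union> (X - S1)) + f (X \<inter> S1) \<le> f S1 + f S2 + 2 f S3 + 4 \<tau> d\<close>,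
  and \<open>f X \<ge> 4 (d + 1) \<tau>\<close> forces one of the three sets to have value at least \<open>\<tau>\<close>.
\<close>

section \<open>Running programs\<close>

lemma run_bind: "run f U (bind_prog p k) = run f U (k (run f U p))"
  by (induction p) auto

lemma num_queries_bind:
  "num_queries f U (bind_prog p k) = num_queries f U p + num_queries f U (k (run f U p))"
  by (induction p) auto

lemma run_traverse: "run f U (traverse g xs) = map (\<lambda>x. run f U (g x)) xs"
  by (induction xs) (auto simp: run_bind)

lemma num_queries_traverse:
  "num_queries f U (traverse g xs) = (\<Sum>x\<leftarrow>xs. num_queries f U (g x))"
  by (induction xs) (auto simp: num_queries_bind)

text \<open>Slots never interact, so scanning the stream with all of them amounts to one separate
  scan per guess; this lets each guess be analysed alone.\<close>

lemma fold_map_pointwise: "fold (\<lambda>u. map (h u)) us xs = map (fold h us) xs"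
  by (induction us arbitrary: xs) auto

text \<open>The assumption is the loop invariant: \<open>x\<close> caches the value of the best set
  so far, and both branches of the recursion preserve this.\<close>

lemma run_largest_from:
  assumes "x = f S"
  shows "run f U (largest_from S x Ts) \<in> set (S # Ts) \<and>
    (\<forall>T\<in>set (S # Ts). f T \<le> f (run f U (largest_from S x Ts)))"
  using assms
proof (induction Ts arbitrary: S x)
  case (Cons T Ts)
  show ?case
    using Cons.IH[of "f T" T] Cons.IH[of "f S" S] Cons.prems by auto
qed simp

lemma run_largest:
  assumes "Ts \<noteq> []"
  shows "run f U (largest Ts) \<in> set Ts" "T \<in> set Ts \<Longrightarrow> f T \<le> f (run f U (largest Ts))"
proof -
  obtain S Ss where Ts: "Ts = S # Ss" using assms by (cases Ts) auto
  show "run f U (largest Ts) \<in> set Ts" "T \<in> set Ts \<Longrightarrow> f T \<le> f (run f U (largest Ts))"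
    using run_largest_from[of "f S" f S U Ss] by (auto simp: Ts)
qed

lemma num_queries_largest_from: "num_queries f U (largest_from S x Ts) = length Ts"
  by (induction Ts arbitrary: S x) auto

lemma num_queries_largest: "num_queries f U (largest Ts) = length Ts"
  by (cases Ts) (auto simp: num_queries_largest_from)

text \<open>The longest path asks for the singleton and then for two values per marginal gain, once
  for \<open>S1\<close> and once for \<open>S2\<close>.\<close>

lemma num_queries_update_slot: "num_queries f U (update_slot d b c j s) \<le> 5"
  by (simp add: update_slot_def Let_def)

section \<open>Submodular functions\<close>

lemma submodular_gain_antimono:
  assumes "submodular_on N f" "S \<subseteq> T" "T \<subseteq> N" "j \<in> N" "j \<notin> T"
  shows "f (T \<union> {j}) - f T \<le> f (S \<union> {j}) - f S"
proof -
  have "f (S \<union> {j}) + f T \<ge> f ((S \<union> {j}) \<union> T) + f ((S \<union> {j}) \<inter> T)"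
    using assms(1)[unfolded submodular_on_def, rule_format, of "S \<union> {j}" T] assms(2-) by auto
  moreover have "(S \<union> {j}) \<union> T = T \<union> {j}" "(S \<union> {j}) \<inter> T = S"
    using assms by auto
  ultimately show ?thesis by simp
qed

lemma submodular_union_le_gains:
  assumes sub: "submodular_on N f" and "finite A" "A \<subseteq> N" "S \<subseteq> N" "A \<inter> S = {}"
  shows "f (S \<union> A) \<le> f S + (\<Sum>j\<in>A. f (S \<union> {j}) - f S)"
  using assms(2-)
proof (induction A rule: finite_induct)
  case (insert j A)
  have "f ((S \<union> A) \<union> {j}) - f (S \<union> A) \<le> f (S \<union> {j}) - f S"
    using insert by (intro submodular_gain_antimono[OF sub]) auto
  with insert show ?case by simp
qed simp

text \<open>Disjointness makes \<open>A \<union> X\<close> and \<open>B \<union> (X - A)\<close>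
  meet exactly in \<open>X - A\<close>; a second use of submodularity splits \<open>X\<close> along
  \<open>A\<close>. Nonnegativity discards the leftover values, which stands in for
  monotonicity.\<close>

lemma submodular_split:
  assumes sub: "submodular_on N f" and nn: "\<And>S. S \<subseteq> N \<Longrightarrow> f S \<ge> 0"
    and "A \<subseteq> N" "B \<subseteq> N" "X \<subseteq> N" "A \<inter> B = {}"
  shows "f X \<le> f (A \<union> X) + f (B \<union> (X - A)) + f (X \<inter> A)"
proof -
  let ?C = "(A \<union> X) \<inter> (B \<union> (X - A))"
  have sub': "f (S \<union> T) + f (S \<inter> T) \<le> f S + f T" if "S \<subseteq> N" "T \<subseteq> N" for S T
    using sub that unfolding submodular_on_def by blast
  have "?C = X - A" using assms by auto
  moreover have "f ((A \<union> X) \<union> (B \<union> (X - A))) + f ?C \<le> f (A \<union> X) + f (B \<union> (X - A))"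
    using assms by (intro sub') auto
  moreover have "f ((A \<union> X) \<union> (B \<union> (X - A))) \<ge> 0" using assms by (intro nn) auto
  moreover have "f ((X - A) \<union> (X \<inter> A)) + f ((X - A) \<inter> (X \<inter> A)) \<le> f (X - A) + f (X \<inter> A)"
    using assms by (intro sub') auto
  moreover have "(X - A) \<union> (X \<inter> A) = X" by auto
  moreover have "f ((X - A) \<inter> (X \<inter> A)) \<ge> 0" using assms by (intro nn) auto
  ultimately show ?thesis by simp
qed

section \<open>The set of guesses\<close>

text \<open>The admissible exponents lie in an interval of length
  \<open>ln b / ln (1 + \<epsilon>) + 1\<close>, and the number of integers in it exceeds its length
  by at most 1.\<close>

definition guess_bound :: "real \<Rightarrow> real \<Rightarrow> real" where
  "guess_bound b \<epsilon> = ln b / ln (1 + \<epsilon>) + 2"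

lemma guesses_pos:
  assumes "\<epsilon> > 0" "v \<in> guesses b \<epsilon> m"
  shows "v > 0"
  using assms by (auto simp: guesses_def)

lemma powi_exponent_floor:
  fixes \<epsilon> x :: real
  assumes "\<epsilon> > 0" "x > 0"
  shows "(1 + \<epsilon>) powi \<lfloor>log (1 + \<epsilon>) x\<rfloor> \<le> x" "x < (1 + \<epsilon>) powi \<lfloor>log (1 + \<epsilon>) x\<rfloor> * (1 + \<epsilon>)"
proof -
  let ?i = "\<lfloor>log (1 + \<epsilon>) x\<rfloor>"
  have powi: "(1 + \<epsilon>) powi k = (1 + \<epsilon>) powr (of_int k)" for k
    using assms by (simp add: powr_real_of_int')
  have x: "x = (1 + \<epsilon>) powr log (1 + \<epsilon>) x" using assms by simp
  show "(1 + \<epsilon>) powi ?i \<le> x"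
    unfolding powi by (subst (2) x, rule powr_mono) (use assms in auto)
  have "x < (1 + \<epsilon>) powr (of_int ?i + 1)"
    by (subst x, rule powr_less_mono) (use assms in auto)
  also have "\<dots> = (1 + \<epsilon>) powi ?i * (1 + \<epsilon>)"
    using assms by (simp add: powr_add powi)
  finally show "x < (1 + \<epsilon>) powi ?i * (1 + \<epsilon>)" .
qed

text \<open>Round \<open>x\<close> down to a power of \<open>1 + \<epsilon>\<close>. This may lose
  almost a factor \<open>1 + \<epsilon>\<close>, which is why the guesses start at
  \<open>m / (1 + \<epsilon>)\<close> and not at \<open>m\<close>.\<close>

lemma guess_near:
  assumes "\<epsilon> > 0" "m > 0" "m \<le> x" "x \<le> b * m"
  obtains v where "v \<in> guesses b \<epsilon> m" "v \<le> x" "x \<le> v * (1 + \<epsilon>)"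
proof -
  define i where "i = \<lfloor>log (1 + \<epsilon>) x\<rfloor>"
  note fl = powi_exponent_floor[of \<epsilon> x, folded i_def]
  have le: "(1 + \<epsilon>) powi i \<le> x" "x < (1 + \<epsilon>) powi i * (1 + \<epsilon>)" using fl assms by auto
  then have "m / (1 + \<epsilon>) \<le> (1 + \<epsilon>) powi i"
    using assms by (simp add: pos_divide_le_eq)
  with le assms have "(1 + \<epsilon>) powi i \<in> guesses b \<epsilon> m"
    unfolding guesses_def by auto
  then show thesis using that le by auto
qed

lemma guesses_zero: "\<epsilon> > 0 \<Longrightarrow> guesses b \<epsilon> 0 = {}"
  by (auto simp: guesses_def not_le)

lemma guesses_finite_card:
  assumes "\<epsilon> > 0" "b \<ge> 1" "m \<ge> 0"
  shows "finite (guesses b \<epsilon> m)" "real (card (guesses b \<epsilon> m)) \<le> guess_bound b \<epsilon>"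
proof -
  have L: "ln (1 + \<epsilon>) > 0" using assms by simp
  have "finite (guesses b \<epsilon> m) \<and> real (card (guesses b \<epsilon> m)) \<le> guess_bound b \<epsilon>"
  proof (cases "m = 0")
    case True
    then show ?thesis using assms L by (simp add: guesses_zero guess_bound_def)
  next
    case False
    then have m: "m > 0" using assms by simp
    \<comment> \<open>The two ends of the range of guesses, as logarithms in base
      \<open>1 + \<epsilon>\<close>.\<close>
    define lo where "lo = ln m / ln (1 + \<epsilon>) - 1"
    define hi where "hi = (ln b + ln m) / ln (1 + \<epsilon>)"
    define I where "I = {\<lceil>lo\<rceil>..\<lfloor>hi\<rfloor>}"
    have "guesses b \<epsilon> m \<subseteq> (\<lambda>i. (1 + \<epsilon>) powi i) ` I"
    proof
      fix v assume "v \<in> guesses b \<epsilon> m"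
      then obtain i :: int where i: "v = (1 + \<epsilon>) powi i" "m / (1 + \<epsilon>) \<le> v" "v \<le> b * m"
        unfolding guesses_def by auto
      have v: "v > 0" using i assms by simp
      have lnv: "ln v = i * ln (1 + \<epsilon>)"
        using assms i by (simp add: powr_real_of_int'[symmetric])
      have "ln (m / (1 + \<epsilon>)) \<le> ln v" using i v m assms by (subst ln_le_cancel_iff) auto
      then have "ln m - ln (1 + \<epsilon>) \<le> i * ln (1 + \<epsilon>)"
        using assms m by (simp add: ln_div lnv)
      then have "lo \<le> i" using L by (simp add: lo_def field_simps)
      moreover have "ln v \<le> ln (b * m)" using i v m assms by (subst ln_le_cancel_iff) auto
      then have "i * ln (1 + \<epsilon>) \<le> ln b + ln m"
        using assms m by (simp add: ln_mult lnv)
      then have "i \<le> hi" using L by (simp add: hi_def field_simps)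
      ultimately have "i \<in> I" by (simp add: I_def ceiling_le_iff le_floor_iff)
      then show "v \<in> (\<lambda>i. (1 + \<epsilon>) powi i) ` I" using i by blast
    qed
    moreover have "finite I" by (simp add: I_def)
    ultimately have "finite (guesses b \<epsilon> m)" "card (guesses b \<epsilon> m) \<le> card I"
      by (auto intro: finite_subset surj_card_le)
    moreover have "real (card I) \<le> guess_bound b \<epsilon>"
    proof -
      have "hi - lo = ln b / ln (1 + \<epsilon>) + 1" by (simp add: hi_def lo_def add_divide_distrib)
      moreover have "0 \<le> ln b / ln (1 + \<epsilon>)" using L assms by simp
      ultimately have *: "hi - lo + 1 = guess_bound b \<epsilon>" "guess_bound b \<epsilon> \<ge> 2"
        by (auto simp: guess_bound_def)
      have "of_int (\<lfloor>hi\<rfloor> - \<lceil>lo\<rceil> + 1) \<le> hi - lo + 1"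
        using of_int_floor_le[of hi] le_of_int_ceiling[of lo]
        unfolding of_int_add of_int_diff of_int_1 by linarith
      with * show ?thesis by (simp add: I_def)
    qed
    ultimately show ?thesis by linarith
  qed
  then show "finite (guesses b \<epsilon> m)" "real (card (guesses b \<epsilon> m)) \<le> guess_bound b \<epsilon>" by auto
qed

section \<open>Asymptotics of the resource bounds\<close>

lemma guess_bound_le:
  assumes "\<beta> > 1" "\<eta> > 0" "b \<ge> \<beta>" "0 < \<epsilon>" "\<epsilon> \<le> \<eta>"
  shows "guess_bound b \<epsilon> \<le> (1 + \<eta> + 2 * \<eta> / ln \<beta>) * (ln b / \<epsilon>)"
proof -
  \<comment> \<open>\<open>ln x \<le> x - 1\<close> at the reciprocal of
    \<open>1 + \<epsilon>\<close> yields a lower bound on \<open>ln (1 + \<epsilon>)\<close> that is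
    linear in \<open>\<epsilon>\<close> as long as \<open>\<epsilon> \<le> \<eta>\<close>.\<close>
  have "ln (1 / (1 + \<epsilon>)) \<le> 1 / (1 + \<epsilon>) - 1"
    using assms by (intro ln_le_minus_one) auto
  then have "1 - 1 / (1 + \<epsilon>) \<le> ln (1 + \<epsilon>)" using assms by (simp add: ln_div)
  moreover have "1 - 1 / (1 + \<epsilon>) = \<epsilon> / (1 + \<epsilon>)" using assms by (simp add: field_simps)
  moreover have "\<epsilon> / (1 + \<eta>) \<le> \<epsilon> / (1 + \<epsilon>)" using assms by (intro divide_left_mono) auto
  ultimately have L: "\<epsilon> / (1 + \<eta>) \<le> ln (1 + \<epsilon>)" by linarith
  have b: "0 < ln \<beta>" "ln \<beta> \<le> ln b" using assms by auto
  have "ln b / ln (1 + \<epsilon>) \<le> ln b / (\<epsilon> / (1 + \<eta>))"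
    using L b assms by (intro divide_left_mono) auto
  also have "\<dots> = (1 + \<eta>) * (ln b / \<epsilon>)" by simp
  finally have 1: "ln b / ln (1 + \<epsilon>) \<le> (1 + \<eta>) * (ln b / \<epsilon>)" .
  \<comment> \<open>Both ratios are at least 1 on the region, so the additive constant 2 is absorbed
    into \<open>ln b / \<epsilon>\<close>.\<close>
  have "1 * 1 \<le> (\<eta> / \<epsilon>) * (ln b / ln \<beta>)"
    using assms b by (intro mult_mono) auto
  then have "2 \<le> 2 * ((\<eta> / \<epsilon>) * (ln b / ln \<beta>))" by simp
  also have "\<dots> = 2 * \<eta> / ln \<beta> * (ln b / \<epsilon>)" by (simp add: mult_ac)
  finally have "2 \<le> 2 * \<eta> / ln \<beta> * (ln b / \<epsilon>)" .
  with 1 show ?thesis unfolding guess_bound_def distrib_right by linarith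
qed

text \<open>The leading 1 is the arriving element; a slot holds up to \<open>b\<close> elements in
  each of \<open>S1\<close>, \<open>S2\<close>, \<open>S3\<close> and at most one in
  \<open>S0\<close>.\<close>

definition space_bound :: "real \<times> real \<Rightarrow> real" where
  "space_bound = (\<lambda>(b, \<epsilon>). 1 + guess_bound b \<epsilon> * (3 * b + 1))"

text \<open>An arrival costs up to five queries per slot and the final comparison four, so one bound
  covers both.\<close>

definition query_bound :: "real \<times> real \<Rightarrow> real" where
  "query_bound = (\<lambda>(b, \<epsilon>). 5 * guess_bound b \<epsilon>)"

lemma guess_bound_ge_2:
  assumes "b \<ge> 1" "\<epsilon> > 0"
  shows "guess_bound b \<epsilon> \<ge> 2"
  using assms by (simp add: guess_bound_def)

text \<open>The filter \<open>principal\<close> asks for one constant on the whole region. Since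
  \<open>guess_bound\<close> is at least 2, the region must avoid \<open>b = 1\<close>, where
  \<open>ln b\<close> vanishes, and large \<open>\<epsilon>\<close>, where
  \<open>ln b / \<epsilon>\<close> tends to 0.\<close>

lemma bounds_bigo:
  assumes "\<beta> > 1" "\<eta> > 0"
  shows "space_bound \<in> O[principal ({\<beta>..} \<times> {0<..\<eta>})](\<lambda>(b, \<epsilon>). b * ln b / \<epsilon>)"
    and "query_bound \<in> O[principal ({\<beta>..} \<times> {0<..\<eta>})](\<lambda>(b, \<epsilon>). ln b / \<epsilon>)"
proof -
  define C where "C = 1 + \<eta> + 2 * \<eta> / ln \<beta>"
  have bound: "guess_bound b \<epsilon> \<le> C * (ln b / \<epsilon>)" "guess_bound b \<epsilon> \<ge> 2"
    if "b \<ge> \<beta>" "0 < \<epsilon>" "\<epsilon> \<le> \<eta>" for b \<epsilon>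
    using guess_bound_le[of \<beta> \<eta> b \<epsilon>] guess_bound_ge_2[of b \<epsilon>] that assms by (auto simp: C_def)
  show "query_bound \<in> O[principal ({\<beta>..} \<times> {0<..\<eta>})](\<lambda>(b, \<epsilon>). ln b / \<epsilon>)"
  proof (rule bigoI[where c = "5 * C"], clarsimp simp: eventually_principal, goal_cases)
    case (1 b \<epsilon>)
    have "ln b > 0" using 1 assms by simp
    then show ?case using bound[of b \<epsilon>] 1 by (simp add: query_bound_def)
  qed
  show "space_bound \<in> O[principal ({\<beta>..} \<times> {0<..\<eta>})](\<lambda>(b, \<epsilon>). b * ln b / \<epsilon>)"
  proof (rule bigoI[where c = "5 * C"], clarsimp simp: eventually_principal, goal_cases)
    case (1 b \<epsilon>)
    let ?g = "guess_bound b \<epsilon>"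
    have b: "ln b > 0" "b \<ge> 1" using 1 assms by auto
    have g: "?g \<le> C * (ln b / \<epsilon>)" "?g \<ge> 2" using bound[of b \<epsilon>] 1 by auto
    have "1 * 1 \<le> ?g * b" using g b by (intro mult_mono) auto
    moreover have "?g * (3 * b + 1) \<le> ?g * (4 * b)" using g b by (intro mult_left_mono) auto
    ultimately have "1 + ?g * (3 * b + 1) \<le> 5 * b * ?g" by (simp add: algebra_simps)
    also have "\<dots> \<le> 5 * b * (C * (ln b / \<epsilon>))" using g b by (intro mult_left_mono) auto
    finally have "1 + ?g * (3 * b + 1) \<le> 5 * C * (b * ln b / \<epsilon>)" by (simp add: algebra_simps)
    moreover have "0 \<le> ?g * (3 * b + 1)" using g b by simp
    ultimately show ?case using 1 b by (simp add: space_bound_def)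
  qed
qed

section \<open>One guess\<close>

locale knapsack =
  fixes n d :: nat and b :: real and c :: "nat \<Rightarrow> nat \<Rightarrow> real"
    and f :: "nat set \<Rightarrow> real" and U :: "nat set \<Rightarrow> nat set"
  assumes n: "n \<ge> 1" and d: "d \<ge> 1" and std: "standardized_knapsack n d b c"
    and nonneg: "S \<subseteq> {1..n} \<Longrightarrow> f S \<ge> 0"
    and sub: "submodular_on {1..n} f"
    and U: "unconstrained_half_approx {1..n} f U"
begin

lemma cost: "i \<in> {1..d} \<Longrightarrow> j \<in> {1..n} \<Longrightarrow> 1 \<le> c i j" "i \<in> {1..d} \<Longrightarrow> j \<in> {1..n} \<Longrightarrow> c i j \<le> b"
  using std by (auto simp: standardized_knapsack_def)

lemma b: "b \<ge> 1"
  using cost[of 1 1] n d by simp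

lemma feasible_mono:
  assumes "feasible d b c S" "T \<subseteq> S" "S \<subseteq> {1..n}"
  shows "feasible d b c T"
  unfolding feasible_def
proof
  fix i assume i: "i \<in> {1..d}"
  have "finite S" using assms finite_subset by blast
  moreover have "0 \<le> c i j" if "j \<in> S - T" for j
    using cost(1)[OF i, of j] that assms(3) by auto
  ultimately have "(\<Sum>j\<in>T. c i j) \<le> (\<Sum>j\<in>S. c i j)"
    using assms by (intro sum_mono2) auto
  also have "\<dots> \<le> b" using assms i by (auto simp: feasible_def)
  finally show "(\<Sum>j\<in>T. c i j) \<le> b" .
qed

text \<open>Every cost is at least 1, so the first dimension alone limits the cardinality.\<close>

lemma card_feasible:
  assumes "feasible d b c S" "S \<subseteq> {1..n}"
  shows "real (card S) \<le> b"
proof -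
  have "real (card S) = (\<Sum>j\<in>S. 1)" by simp
  also have "\<dots> \<le> (\<Sum>j\<in>S. c 1 j)" using cost(1)[of 1] d assms by (intro sum_mono) auto
  also have "\<dots> \<le> b" using assms d by (auto simp: feasible_def)
  finally show ?thesis .
qed

lemma feasible_singleton: "j \<in> {1..n} \<Longrightarrow> feasible d b c {j}"
  using cost by (auto simp: feasible_def)

lemma gain_antimono:
  "S \<subseteq> T \<Longrightarrow> T \<subseteq> {1..n} \<Longrightarrow> j \<in> {1..n} \<Longrightarrow> j \<notin> T \<Longrightarrow> f (T \<union> {j}) - f T \<le> f (S \<union> {j}) - f S"
  using submodular_gain_antimono[OF sub] .

definition threshold :: "real \<Rightarrow> real" where
  "threshold v = v / (4 * (real d + 1))"

definition big :: "real \<Rightarrow> nat \<Rightarrow> bool" where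
  "big v j \<longleftrightarrow> (\<exists>i\<in>{1..d}. c i j \<ge> b / 2 \<and> f {j} / c i j \<ge> 2 * threshold v / b)"

definition accepts :: "real \<Rightarrow> nat \<Rightarrow> nat set \<Rightarrow> bool" where
  "accepts v j S \<longleftrightarrow> admits d b c (threshold v) j S (f (S \<union> {j}) - f S)"

definition step :: "nat \<Rightarrow> slot \<Rightarrow> slot" where
  "step j s = run f U (update_slot d b c j s)"

text \<open>Answering the queries by \<open>f\<close> turns the program into a case distinction on
  sets, from which the invariant is proved.\<close>

lemma step_eq:
  "step j s =
    (if big (guess s) j then s\<lparr>S0 := {j}\<rparr>
     else if accepts (guess s) j (S1 s) then s\<lparr>S1 := S1 s \<union> {j}\<rparr>
     else if accepts (guess s) j (S2 s) then s\<lparr>S2 := S2 s \<union> {j}\<rparr>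
     else s)"
  by (simp only: step_def update_slot_def Let_def big_def accepts_def threshold_def run.simps
      if_distrib[of "run f U"])

section \<open>One slot during the scan\<close>

definition empty_slot :: "real \<Rightarrow> slot" where
  "empty_slot v = \<lparr>guess = v, S0 = {}, S1 = {}, S2 = {}, S3 = {}\<rparr>"

definition slot_after :: "nat \<Rightarrow> real \<Rightarrow> slot" where
  "slot_after k v = fold step [1..<k+1] (empty_slot v)"

lemma slot_after_0: "slot_after 0 v = empty_slot v"
  by (simp add: slot_after_def)

lemma slot_after_Suc: "slot_after (Suc k) v = step (Suc k) (slot_after k v)"
  by (simp add: slot_after_def)

text \<open>The bound is kept in every dimension at once, since an overflow may later occur in any
  of them. It starts from \<open>f {}\<close>, to which the accepted gains add up.\<close>

definition dense :: "real \<Rightarrow> nat \<Rightarrow> nat set \<Rightarrow> bool" where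
  "dense v k S \<longleftrightarrow> S \<subseteq> {1..k} \<and> feasible d b c S \<and>
     (\<forall>i\<in>{1..d}. f S \<ge> f {} + 2 * threshold v / b * (\<Sum>j\<in>S. c i j))"

lemma dense_empty: "dense v k {}"
  using b by (auto simp: dense_def feasible_def)

lemma dense_mono: "dense v k S \<Longrightarrow> k \<le> l \<Longrightarrow> dense v l S"
  by (auto simp: dense_def)

lemma dense_insert:
  assumes "dense v k S" "accepts v (Suc k) S" "Suc k \<le> n"
  shows "dense v (Suc k) (S \<union> {Suc k})"
proof -
  have S: "S \<subseteq> {1..k}" using assms by (simp add: dense_def)
  then have fin: "finite S" "Suc k \<notin> S" using finite_subset by fastforce+
  have "f S + 2 * threshold v / b * c i (Suc k) \<le> f (S \<union> {Suc k})" if "i \<in> {1..d}" for i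
  proof -
    have "0 < c i (Suc k)" using cost(1)[OF that, of "Suc k"] assms by simp
    moreover have "2 * threshold v / b \<le> (f (S \<union> {Suc k}) - f S) / c i (Suc k)"
      using assms(2) that unfolding accepts_def admits_def by blast
    ultimately have "2 * threshold v / b * c i (Suc k) \<le> f (S \<union> {Suc k}) - f S"
      by (simp only: pos_le_divide_eq)
    then show ?thesis by simp
  qed
  moreover have "f S \<ge> f {} + 2 * threshold v / b * (\<Sum>j\<in>S. c i j)" if "i \<in> {1..d}" for i
    using assms(1) that by (auto simp: dense_def)
  ultimately have "f {} + 2 * threshold v / b * (\<Sum>j\<in>S \<union> {Suc k}. c i j) \<le> f (S \<union> {Suc k})"
    if "i \<in> {1..d}" for i
    using that fin by (fastforce simp: distrib_left)
  moreover have "feasible d b c (S \<union> {Suc k})"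
    using assms(2) by (simp add: accepts_def admits_def feasible_def)
  ultimately show ?thesis using S by (auto simp: dense_def)
qed

text \<open>\<open>S'\<close> is the state of the growing set \<open>S\<close> at the arrival of \<open>j\<close>.\<close>

definition rejected :: "real \<Rightarrow> nat \<Rightarrow> nat set \<Rightarrow> bool" where
  "rejected v j S \<longleftrightarrow> (\<exists>S'\<subseteq>S. \<not> accepts v j S')"

lemma rejected_mono: "rejected v j S \<Longrightarrow> S \<subseteq> T \<Longrightarrow> rejected v j T"
  by (auto simp: rejected_def)

text \<open>\<open>S0\<close> is nonempty once a big element has arrived, so an empty
  \<open>S0\<close> at the end certifies that there was none. Rejection by \<open>S2\<close> is
  recorded only for elements missing from both sets, because \<open>S2\<close> is tried only after
  \<open>S1\<close> has refused.\<close>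

definition slot_inv :: "real \<Rightarrow> nat \<Rightarrow> slot \<Rightarrow> bool" where
  "slot_inv v k s \<longleftrightarrow> guess s = v \<and> S3 s = {} \<and>
     dense v k (S1 s) \<and> dense v k (S2 s) \<and> S1 s \<inter> S2 s = {} \<and>
     (S0 s = {} \<or> (\<exists>j\<in>{1..k}. S0 s = {j} \<and> big v j)) \<and>
     (\<forall>j\<in>{1..k}. big v j \<longrightarrow> S0 s \<noteq> {}) \<and>
     (\<forall>j\<in>{1..k}. \<not> big v j \<longrightarrow> j \<notin> S1 s \<longrightarrow> rejected v j (S1 s)) \<and>
     (\<forall>j\<in>{1..k}. \<not> big v j \<longrightarrow> j \<notin> S1 s \<longrightarrow> j \<notin> S2 s \<longrightarrow> rejected v j (S2 s))"

text \<open>One case per branch of the update. A growing set keeps its past rejections, because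
  \<open>rejected\<close> only asks for some subset that refused.\<close>

lemma slot_inv_step:
  assumes inv: "slot_inv v k s" and k: "Suc k \<le> n"
  shows "slot_inv v (Suc k) (step (Suc k) s)"
proof -
  have at: "{1..Suc k} = insert (Suc k) {1..k}" by auto
  have v: "guess s = v" and dn: "dense v k (S1 s)" "dense v k (S2 s)"
    using inv by (auto simp: slot_inv_def)
  have dn': "dense v (Suc k) (S1 s)" "dense v (Suc k) (S2 s)"
    using dn dense_mono by auto
  have new: "Suc k \<notin> S1 s" "Suc k \<notin> S2 s"
    using dn by (auto simp: dense_def)
  have self: "rejected v (Suc k) S" if "\<not> accepts v (Suc k) S" for S
    using that by (auto simp: rejected_def)
  consider "big v (Suc k)" | "\<not> big v (Suc k)" "accepts v (Suc k) (S1 s)"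
    | "\<not> big v (Suc k)" "\<not> accepts v (Suc k) (S1 s)" "accepts v (Suc k) (S2 s)"
    | "\<not> big v (Suc k)" "\<not> accepts v (Suc k) (S1 s)" "\<not> accepts v (Suc k) (S2 s)" by blast
  then show ?thesis
  proof cases
    case 1
    then show ?thesis using inv dn' unfolding slot_inv_def at step_eq v by (auto simp: v)
  next
    case 2
    have mono: "rejected v j (S1 s \<union> {Suc k})" if "rejected v j (S1 s)" for j
      using that rejected_mono by blast
    show ?thesis
      using 2 inv dn' dense_insert[OF dn(1) 2(2) k] new mono
      unfolding slot_inv_def at step_eq v by (auto simp: v)
  next
    case 3
    have mono: "rejected v j (S2 s \<union> {Suc k})" if "rejected v j (S2 s)" for j
      using that rejected_mono by blast
    show ?thesis
      using 3 inv dn' dense_insert[OF dn(2) 3(3) k] new mono self[OF 3(2)]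
      unfolding slot_inv_def at step_eq v by (auto simp: v)
  next
    case 4
    then show ?thesis using inv dn' self unfolding slot_inv_def at step_eq v by (auto simp: v)
  qed
qed

lemma slot_inv_slot_after: "k \<le> n \<Longrightarrow> slot_inv v k (slot_after k v)"
proof (induction k)
  case 0
  show ?case by (auto simp: slot_inv_def slot_after_0 empty_slot_def dense_empty)
next
  case (Suc k)
  then show ?case by (auto simp: slot_after_Suc intro: slot_inv_step)
qed

section \<open>One slot after the stream\<close>

definition final_slot :: "real \<Rightarrow> slot" where
  "final_slot v = (let s = slot_after n v in s\<lparr>S3 := U (S1 s)\<rparr>)"

definition candidates :: "slot \<Rightarrow> nat set list" where
  "candidates s = [S1 s, S2 s, S3 s, S0 s]"

lemma U_subset: "A \<subseteq> {1..n} \<Longrightarrow> U A \<subseteq> A"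
  using U by (auto simp: unconstrained_half_approx_def)

lemma U_half:
  assumes "A \<subseteq> {1..n}" "T \<subseteq> A"
  shows "f T \<le> 2 * f (U A)"
proof -
  have "finite A" using assms finite_subset by blast
  then have "f T \<le> Max (f ` Pow A)" using assms by (intro Max_ge) auto
  moreover have "f (U A) \<ge> 1/2 * Max (f ` Pow A)"
    using U assms by (auto simp: unconstrained_half_approx_def)
  ultimately show ?thesis by simp
qed

lemma slot_storage:
  assumes "slot_inv v k s" "k \<le> n"
  shows "real (card (S0 s)) \<le> 1" "real (card (S1 s)) \<le> b" "real (card (S2 s)) \<le> b"
proof -
  have "dense v n (S1 s)" "dense v n (S2 s)"
    using assms dense_mono by (auto simp: slot_inv_def)
  then show "real (card (S1 s)) \<le> b" "real (card (S2 s)) \<le> b"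
    unfolding dense_def using card_feasible by blast+
  show "real (card (S0 s)) \<le> 1" using assms(1) by (auto simp: slot_inv_def)
qed

text \<open>The invariant covers all candidates except \<open>S3\<close>, which is a subset of
  \<open>S1\<close>; feasibility passes to subsets.\<close>

lemma final_slot_feasible:
  assumes "T \<in> set (candidates (final_slot v))"
  shows "T \<subseteq> {1..n}" "feasible d b c T"
proof -
  let ?s = "slot_after n v"
  have inv: "slot_inv v n ?s" using slot_inv_slot_after by simp
  have S: "S1 ?s \<subseteq> {1..n}" "S2 ?s \<subseteq> {1..n}" "feasible d b c (S1 ?s)" "feasible d b c (S2 ?s)"
    using inv by (auto simp: slot_inv_def dense_def)
  have "U (S1 ?s) \<subseteq> S1 ?s" using U_subset S by simp
  moreover from this have "feasible d b c (U (S1 ?s))" using feasible_mono S by simp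
  moreover have "S0 ?s \<subseteq> {1..n}" "feasible d b c (S0 ?s)"
    using inv feasible_singleton b by (auto simp: slot_inv_def) (auto simp: feasible_def)
  ultimately show "T \<subseteq> {1..n}" "feasible d b c T"
    using assms S by (auto simp: candidates_def final_slot_def Let_def)
qed

lemma final_slot_storage:
  "real (card (S0 (final_slot v)) + card (S1 (final_slot v)) + card (S2 (final_slot v))
     + card (S3 (final_slot v))) \<le> 3 * b + 1"
proof -
  let ?s = "slot_after n v"
  have inv: "slot_inv v n ?s" using slot_inv_slot_after by simp
  have "real (card (U (S1 ?s))) \<le> b"
    using final_slot_feasible[of "U (S1 ?s)" v] card_feasible
    by (simp add: candidates_def final_slot_def Let_def)
  then show ?thesis using slot_storage[OF inv] by (simp add: final_slot_def Let_def)
qed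

lemma slot_after_storage:
  assumes "k \<le> n"
  shows "real (card (S0 (slot_after k v)) + card (S1 (slot_after k v)) + card (S2 (slot_after k v))
     + card (S3 (slot_after k v))) \<le> 3 * b + 1"
proof -
  have inv: "slot_inv v k (slot_after k v)" using slot_inv_slot_after assms by simp
  then have "S3 (slot_after k v) = {}" by (simp add: slot_inv_def)
  then show ?thesis using slot_storage[OF inv assms] b by simp
qed

text \<open>
  If a dense enough gain is rejected by the capacity in dimension \<open>i\<close>, then the element, not
  being big, costs less than \<open>b / 2\<close>, so the set is already more than half full.
\<close>

lemma rejected_gain:
  assumes S: "dense v n S" and lt: "f S < threshold v" and rej: "rejected v j S"
    and j: "j \<in> {1..n}" "j \<notin> S" and nb: "\<not> big v j" and v: "v > 0"
  shows "\<exists>i\<in>{1..d}. f (S \<union> {j}) - f S \<le> 2 * threshold v / b * c i j"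
proof -
  obtain S' where S': "S' \<subseteq> S" "\<not> accepts v j S'" using rej by (auto simp: rejected_def)
  have SN: "S \<subseteq> {1..n}" using S by (simp add: dense_def)
  have \<tau>: "threshold v > 0" using v by (simp add: threshold_def)
  define g where "g = f (S' \<union> {j}) - f S'"
  \<comment> \<open>Marginal gains shrink as the set grows, so low density against \<open>S'\<close>
    persists for the final \<open>S\<close>.\<close>
  have gS: "f (S \<union> {j}) - f S \<le> g"
    unfolding g_def using S' SN j by (intro gain_antimono) auto
  \<comment> \<open>Comparing with the gain over \<open>{}\<close> carries the density of the
    marginal gain to the singleton, which is what \<open>big\<close> tests.\<close>
  have "f (S' \<union> {j}) - f S' \<le> f ({} \<union> {j}) - f {}"
    using S' SN j by (intro gain_antimono) auto
  then have gj: "g \<le> f {j}" using nonneg[of "{}"] by (simp add: g_def)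
  have "\<exists>i\<in>{1..d}. g / c i j < 2 * threshold v / b"
  proof (rule ccontr)
    assume "\<not> ?thesis"
    then have g: "g / c i j \<ge> 2 * threshold v / b" if "i \<in> {1..d}" for i
      using that by (meson not_less)
    then obtain i where i: "i \<in> {1..d}" "(\<Sum>l\<in>S' \<union> {j}. c i l) > b"
      using S' unfolding accepts_def admits_def g_def by fastforce
    have cij: "c i j \<ge> 1" using cost i j by blast
    have "g / c i j \<le> f {j} / c i j" using gj cij by (intro divide_right_mono) auto
    then have "f {j} / c i j \<ge> 2 * threshold v / b" using g[OF i(1)] by linarith
    then have small: "c i j < b / 2" using nb i by (force simp: big_def)
    have fin: "finite S" using SN finite_subset by blast
    \<comment> \<open>The overflow occurred with \<open>S'\<close>; as costs are positive, it occurs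
      with the final \<open>S\<close> as well.\<close>
    have "(\<Sum>l\<in>S' \<union> {j}. c i l) \<le> (\<Sum>l\<in>S \<union> {j}. c i l)"
      using S' fin SN cost(1)[OF i(1)] by (intro sum_mono2) fastforce+
    then have half: "b / 2 < (\<Sum>l\<in>S. c i l)" using i small fin j by simp
    have "threshold v = 2 * threshold v / b * (b / 2)" using b by simp
    also have "\<dots> \<le> 2 * threshold v / b * (\<Sum>l\<in>S. c i l)"
      using half \<tau> b by (intro mult_left_mono) auto
    also have "\<dots> \<le> f {} + 2 * threshold v / b * (\<Sum>l\<in>S. c i l)"
      using nonneg[of "{}"] by simp
    also have "\<dots> \<le> f S" using S i unfolding dense_def by blast
    finally show False using lt by simp
  qed
  then obtain i where i: "i \<in> {1..d}" "g / c i j < 2 * threshold v / b" by blast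
  have "c i j > 0" using cost(1)[OF i(1) j(1)] by simp
  then have "g < 2 * threshold v / b * c i j" using i(2) by (simp only: pos_divide_less_eq)
  then show ?thesis using gS i by force
qed

text \<open>The dimension that witnesses low density varies with the element. Bounding by the sum
  over all dimensions and swapping the sums leaves \<open>d\<close> rows, each of total cost at most
  \<open>b\<close>.\<close>

lemma sum_rejected_gains:
  assumes X: "feasible d b c X" "X \<subseteq> {1..n}" and A: "A \<subseteq> X" and v: "v > 0"
    and gain: "\<And>j. j \<in> A \<Longrightarrow> \<exists>i\<in>{1..d}. g j \<le> 2 * threshold v / b * c i j"
  shows "(\<Sum>j\<in>A. g j) \<le> 2 * threshold v * d"
proof -
  have \<tau>: "threshold v > 0" using v by (simp add: threshold_def)
  have fA: "feasible d b c A" using feasible_mono X A by blast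
  have "(\<Sum>j\<in>A. g j) \<le> (\<Sum>j\<in>A. \<Sum>i\<in>{1..d}. 2 * threshold v / b * c i j)"
  proof (rule sum_mono)
    fix j assume j: "j \<in> A"
    obtain i where i: "i \<in> {1..d}" "g j \<le> 2 * threshold v / b * c i j" using gain[OF j] by blast
    have "0 \<le> c i j" if "i \<in> {1..d}" for i using cost(1)[OF that, of j] j A X by auto
    then have "2 * threshold v / b * c i j \<le> (\<Sum>i\<in>{1..d}. 2 * threshold v / b * c i j)"
      using i \<tau> b by (intro member_le_sum) auto
    with i show "g j \<le> (\<Sum>i\<in>{1..d}. 2 * threshold v / b * c i j)" by linarith
  qed
  also have "\<dots> = (\<Sum>i\<in>{1..d}. 2 * threshold v / b * (\<Sum>j\<in>A. c i j))"
    by (subst sum.swap) (simp add: sum_distrib_left)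
  also have "\<dots> \<le> (\<Sum>i\<in>{1..d}. 2 * threshold v / b * b)"
    using fA \<tau> b by (intro sum_mono mult_left_mono) (auto simp: feasible_def)
  also have "\<dots> = 2 * threshold v * d" using b by simp
  finally show ?thesis .
qed

lemma final_slot_value:
  assumes v: "v > 0" "v \<le> f X" and X: "X \<subseteq> {1..n}" "feasible d b c X"
  shows "\<exists>T\<in>set (candidates (final_slot v)). threshold v \<le> f T"
proof (rule ccontr)
  assume "\<not> ?thesis"
  then have lt: "f T < threshold v" if "T \<in> set (candidates (final_slot v))" for T
    using that by force
  let ?s = "slot_after n v"
  let ?A = "S1 ?s" let ?B = "S2 ?s"
  have lts: "f ?A < threshold v" "f ?B < threshold v" "f (U ?A) < threshold v"
      "f (S0 ?s) < threshold v"
    by (rule lt, simp add: candidates_def final_slot_def Let_def)+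
  have inv: "slot_inv v n ?s" using slot_inv_slot_after by simp
  have dn: "dense v n ?A" "dense v n ?B" and disj: "?A \<inter> ?B = {}"
    using inv by (auto simp: slot_inv_def)
  have N: "?A \<subseteq> {1..n}" "?B \<subseteq> {1..n}" using dn by (auto simp: dense_def)
  have "S0 ?s = {}"
  proof (rule ccontr)
    assume "S0 ?s \<noteq> {}"
    then obtain j i where j: "j \<in> {1..n}" "S0 ?s = {j}" and i: "i \<in> {1..d}" "c i j \<ge> b / 2"
        "f {j} / c i j \<ge> 2 * threshold v / b"
      using inv unfolding slot_inv_def big_def by blast
    have \<tau>: "threshold v > 0" using v by (simp add: threshold_def)
    \<comment> \<open>A big element takes at least half of the capacity in some dimension, at
      density at least \<open>2 * threshold v / b\<close> there.\<close>
    have "threshold v = 2 * threshold v / b * (b / 2)" using b by simp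
    also have "\<dots> \<le> 2 * threshold v / b * c i j"
      using i \<tau> b by (intro mult_left_mono) auto
    also have "\<dots> \<le> f {j}" using i(3) i(2) b by (subst (asm) pos_le_divide_eq) auto
    finally show False using lts j by simp
  qed
  then have nb: "\<not> big v j" if "j \<in> {1..n}" for j
    using inv that by (auto simp: slot_inv_def)
  have fin: "finite X" using X finite_subset by blast
  have gA: "\<exists>i\<in>{1..d}. f (?A \<union> {j}) - f ?A \<le> 2 * threshold v / b * c i j" if "j \<in> X - ?A" for j
  proof -
    have "j \<in> {1..n}" "rejected v j ?A" using that X inv nb by (auto simp: slot_inv_def)
    then show ?thesis using rejected_gain[OF dn(1) lts(1)] that nb v by auto
  qed
  \<comment> \<open>Elements of \<open>?B\<close> can be left out: they do not change the union with
    \<open>?B\<close>, and the invariant records no rejection for them.\<close>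
  have gB: "\<exists>i\<in>{1..d}. f (?B \<union> {j}) - f ?B \<le> 2 * threshold v / b * c i j"
    if "j \<in> X - ?A - ?B" for j
  proof -
    have "j \<in> {1..n}" "rejected v j ?B" using that X inv nb by (auto simp: slot_inv_def)
    then show ?thesis using rejected_gain[OF dn(2) lts(2)] that nb v by auto
  qed
  have "f (?A \<union> (X - ?A)) \<le> f ?A + (\<Sum>j\<in>X - ?A. f (?A \<union> {j}) - f ?A)"
    using X N fin by (intro submodular_union_le_gains[OF sub]) auto
  also have "(\<Sum>j\<in>X - ?A. f (?A \<union> {j}) - f ?A) \<le> 2 * threshold v * d"
    using X v gA by (intro sum_rejected_gains[of X]) auto
  finally have 1: "f (?A \<union> X) \<le> f ?A + 2 * threshold v * d" by simp
  have "f (?B \<union> (X - ?A - ?B)) \<le> f ?B + (\<Sum>j\<in>X - ?A - ?B. f (?B \<union> {j}) - f ?B)"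
    using X N fin by (intro submodular_union_le_gains[OF sub]) auto
  also have "(\<Sum>j\<in>X - ?A - ?B. f (?B \<union> {j}) - f ?B) \<le> 2 * threshold v * d"
    using X v gB by (intro sum_rejected_gains[of X]) auto
  finally have 2: "f (?B \<union> (X - ?A)) \<le> f ?B + 2 * threshold v * d" by simp
  have 3: "f (X \<inter> ?A) \<le> 2 * f (U ?A)" using N by (intro U_half) auto
  have "f X \<le> f (?A \<union> X) + f (?B \<union> (X - ?A)) + f (X \<inter> ?A)"
    using N X disj nonneg by (intro submodular_split[OF sub]) auto
  \<comment> \<open>\<open>f ?A\<close> and \<open>f ?B\<close> count once and
    \<open>f (U ?A)\<close> twice, which makes four thresholds; the two sums of gains add
    \<open>4 * d\<close> more. The divisor in \<open>threshold\<close> is exactly this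
    total.\<close>
  with 1 2 3 lts have "f X < 4 * threshold v + 4 * threshold v * d" by linarith
  also have "\<dots> = 4 * (real d + 1) * threshold v" by (simp add: algebra_simps)
  also have "\<dots> = v" by (simp add: threshold_def)
  finally show False using v by simp
qed

text \<open>For positive \<open>v\<close>, elements enter \<open>S1\<close> only with positive gain.
  This serves the case where the optimum is \<open>{}\<close> and its value lies above the range of
  guesses.\<close>

lemma final_slot_value_empty:
  assumes "v > 0"
  shows "f {} \<le> f (S1 (final_slot v))"
proof -
  let ?A = "S1 (slot_after n v)"
  have "dense v n ?A" using slot_inv_slot_after[of n v] by (simp add: slot_inv_def)
  then have S: "?A \<subseteq> {1..n}" "f ?A \<ge> f {} + 2 * threshold v / b * (\<Sum>j\<in>?A. c 1 j)"
    using d by (auto simp: dense_def)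
  have "0 \<le> (\<Sum>j\<in>?A. c 1 j)" using cost(1)[of 1] d S by (intro sum_nonneg) force
  then have "0 \<le> 2 * threshold v / b * (\<Sum>j\<in>?A. c 1 j)"
    using b assms by (simp add: threshold_def)
  with S show ?thesis by (simp add: final_slot_def Let_def)
qed

section \<open>All guesses\<close>

definition max_density :: real where
  "max_density = Max {f {j} / c i j | i j. i \<in> {1..d} \<and> j \<in> {1..n}}"

lemma densities_finite: "finite {f {j} / c i j | i j. i \<in> {1..d} \<and> j \<in> {1..n}}"
  using finite_image_set2[of "\<lambda>i. i \<in> {1..d}" "\<lambda>j. j \<in> {1..n}"] by simp

lemma max_density_ge: "i \<in> {1..d} \<Longrightarrow> j \<in> {1..n} \<Longrightarrow> f {j} \<le> max_density * c i j"
proof -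
  assume ij: "i \<in> {1..d}" "j \<in> {1..n}"
  have "f {j} / c i j \<le> max_density"
    unfolding max_density_def using ij by (intro Max_ge densities_finite) auto
  moreover have "c i j > 0" using cost(1)[OF ij] by simp
  ultimately show ?thesis by (simp add: pos_divide_le_eq)
qed

lemma max_density_attained:
  obtains i j where "i \<in> {1..d}" "j \<in> {1..n}" "max_density * c i j = f {j}"
proof -
  have "{f {j} / c i j | i j. i \<in> {1..d} \<and> j \<in> {1..n}} \<noteq> {}"
    using n d by fastforce
  then have "max_density \<in> {f {j} / c i j | i j. i \<in> {1..d} \<and> j \<in> {1..n}}"
    unfolding max_density_def by (intro Max_in densities_finite)
  then obtain i j where ij: "i \<in> {1..d}" "j \<in> {1..n}" "max_density = f {j} / c i j" by auto
  moreover have "c i j \<noteq> 0" using cost(1)[OF ij(1,2)] by auto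
  ultimately show thesis using that by simp
qed

lemma max_density_nonneg: "max_density \<ge> 0"
proof -
  obtain i j where ij: "i \<in> {1..d}" "j \<in> {1..n}" "max_density * c i j = f {j}"
    using max_density_attained .
  then have "0 \<le> max_density * c i j" using nonneg[of "{j}"] by auto
  moreover have "c i j > 0" using cost(1)[OF ij(1,2)] by simp
  ultimately show ?thesis by (simp add: zero_le_mult_iff)
qed

lemma opt_finite: "finite (f ` {S. S \<subseteq> {1..n} \<and> feasible d b c S})"
  by (rule finite_imageI, rule finite_subset[of _ "Pow {1..n}"]) auto

lemma OPT_ge: "S \<subseteq> {1..n} \<Longrightarrow> feasible d b c S \<Longrightarrow> f S \<le> OPT n d b c f"
  unfolding OPT_def by (intro Max_ge opt_finite) auto

lemma OPT_attained:
  obtains X where "X \<subseteq> {1..n}" "feasible d b c X" "f X = OPT n d b c f"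
proof -
  have "feasible d b c {}" using b by (simp add: feasible_def)
  then have "f ` {S. S \<subseteq> {1..n} \<and> feasible d b c S} \<noteq> {}" by auto
  then have "OPT n d b c f \<in> f ` {S. S \<subseteq> {1..n} \<and> feasible d b c S}"
    unfolding OPT_def by (intro Max_in opt_finite)
  then show thesis using that by auto
qed

text \<open>A densest singleton is feasible and costs at least 1, so its value is at least its
  density. This is the lower bound on the optimum that \<open>guess_near\<close> asks for.\<close>

lemma max_density_le_OPT: "max_density \<le> OPT n d b c f"
proof -
  obtain i j where ij: "i \<in> {1..d}" "j \<in> {1..n}" "max_density * c i j = f {j}"
    using max_density_attained .
  have "max_density * 1 \<le> max_density * c i j"
    using max_density_nonneg cost(1)[OF ij(1,2)] by (intro mult_left_mono) auto
  also have "\<dots> \<le> OPT n d b c f" using ij OPT_ge feasible_singleton by simp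
  finally show ?thesis by simp
qed

text \<open>
  Since \<open>f {}\<close> may be positive, the upper end \<open>b * max_density\<close> of the guesses bounds only the
  values of nonempty feasible sets.
\<close>

lemma feasible_value_le:
  assumes X: "X \<subseteq> {1..n}" "feasible d b c X" "X \<noteq> {}"
  shows "f X \<le> b * max_density"
proof -
  have fin: "finite X" using X finite_subset by blast
  have "f ({} \<union> X) \<le> f {} + (\<Sum>j\<in>X. f ({} \<union> {j}) - f {})"
    using X fin by (intro submodular_union_le_gains[OF sub]) auto
  then have "f X \<le> f {} + (\<Sum>j\<in>X. f {j}) - card X * f {}"
    by (simp add: sum_subtractf)
  \<comment> \<open>Each element of \<open>X\<close> subtracts one copy of \<open>f {}\<close>, so a
    nonempty \<open>X\<close> cancels the initial one.\<close>
  moreover have "1 * f {} \<le> card X * f {}"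
  proof (rule mult_right_mono)
    show "1 \<le> real (card X)" using fin X(3) by (simp add: Suc_le_eq card_gt_0_iff)
  qed (use nonneg in simp)
  ultimately have "f X \<le> (\<Sum>j\<in>X. f {j})" by simp
  also have "\<dots> \<le> (\<Sum>j\<in>X. max_density * c 1 j)"
    using X d by (intro sum_mono max_density_ge) auto
  also have "\<dots> = max_density * (\<Sum>j\<in>X. c 1 j)" by (simp add: sum_distrib_left)
  also have "\<dots> \<le> max_density * b"
    using X d max_density_nonneg by (intro mult_left_mono) (auto simp: feasible_def)
  finally show ?thesis by (simp add: mult.commute)
qed

section \<open>Guarantees of the whole algorithm\<close>

definition guess_list :: "real \<Rightarrow> real list" where
  "guess_list \<epsilon> = sorted_list_of_set (guesses b \<epsilon> max_density)"

lemma guess_list: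
  assumes "\<epsilon> > 0"
  shows "set (guess_list \<epsilon>) = guesses b \<epsilon> max_density"
    and "real (length (guess_list \<epsilon>)) \<le> guess_bound b \<epsilon>"
  using guesses_finite_card[OF assms b max_density_nonneg] by (auto simp: guess_list_def)

abbreviation stream :: "nat list" where "stream \<equiv> [1..<n+1]"

abbreviation alg :: "real \<Rightarrow> slot list streaming_alg" where
  "alg \<epsilon> \<equiv> B2 d b c \<epsilon> max_density"

lemma scan_traverse: "scan f U us (\<lambda>j. traverse (update_slot d b c j)) s = map (fold step us) s"
  using fold_map_pointwise[of step us s] by (simp add: scan_def run_traverse step_def[abs_def])

lemma init_alg: "init (alg \<epsilon>) = map empty_slot (guess_list \<epsilon>)"
  by (simp add: B2_def guess_list_def empty_slot_def[abs_def])

lemma passes_alg: "passes (alg \<epsilon>) = [\<lambda>j. traverse (update_slot d b c j)]"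
  by (simp add: B2_def)

lemma state_at_alg:
  assumes "k \<le> n"
  shows "state_at f U stream (alg \<epsilon>) 0 k = map (slot_after k) (guess_list \<epsilon>)"
proof -
  have "take k stream = [1..<k+1]" using assms by (subst take_upt) auto
  then show ?thesis
    unfolding state_at_def init_alg passes_alg
    by (simp add: scan_traverse slot_after_def del: upt_Suc)
qed

lemma end_state_alg: "end_state f U stream (alg \<epsilon>) = map (slot_after n) (guess_list \<epsilon>)"
  unfolding end_state_def init_alg passes_alg
  by (simp add: scan_traverse slot_after_def del: upt_Suc)

abbreviation all_candidates :: "real \<Rightarrow> nat set list" where
  "all_candidates \<epsilon> \<equiv> concat (map (\<lambda>v. candidates (final_slot v)) (guess_list \<epsilon>))"

lemma finish_alg:
  "finish (alg \<epsilon>) = (\<lambda>slots.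
     bind_prog (traverse (\<lambda>s. Call (S1 s) (\<lambda>T. Return (s\<lparr>S3 := T\<rparr>))) slots) (\<lambda>slots'.
     bind_prog (largest (concat (map candidates slots'))) (\<lambda>S. Return (slots', S))))"
  by (simp add: B2_def candidates_def[abs_def])

lemma result_alg:
  "result f U stream (alg \<epsilon>)
     = (map final_slot (guess_list \<epsilon>), run f U (largest (all_candidates \<epsilon>)))"
  unfolding result_def end_state_alg finish_alg
  by (simp add: run_bind run_traverse comp_def final_slot_def[abs_def] Let_def)

lemma length_all_candidates: "length (all_candidates \<epsilon>) = 4 * length (guess_list \<epsilon>)"
  by (induction "guess_list \<epsilon>") (auto simp: length_concat comp_def candidates_def sum_list_triv)

lemma output_alg: "output_set f U stream (alg \<epsilon>) = run f U (largest (all_candidates \<epsilon>))"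
  by (simp only: output_set_def result_alg snd_conv)

lemma output_feasible:
  "output_set f U stream (alg \<epsilon>) \<subseteq> {1..n}" "feasible d b c (output_set f U stream (alg \<epsilon>))"
proof -
  let ?S = "output_set f U stream (alg \<epsilon>)"
  have "?S \<subseteq> {1..n} \<and> feasible d b c ?S"
  proof (cases "all_candidates \<epsilon> = []")
    case True
    then have "?S = {}" by (simp only: output_alg) simp
    then show ?thesis using b by (simp add: feasible_def)
  next
    case False
    from run_largest(1)[OF False, of f U] show ?thesis
      unfolding output_alg using final_slot_feasible by auto
  qed
  then show "?S \<subseteq> {1..n}" "feasible d b c ?S" by auto
qed

lemma output_ge:
  assumes "\<epsilon> > 0" "v \<in> guesses b \<epsilon> max_density" "T \<in> set (candidates (final_slot v))"
  shows "f T \<le> f (output_set f U stream (alg \<epsilon>))"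
proof -
  have T: "T \<in> set (all_candidates \<epsilon>)" using assms guess_list by auto
  then have "all_candidates \<epsilon> \<noteq> []" by (metis empty_iff list.set(1))
  from run_largest(2)[OF this T] show ?thesis unfolding output_alg .
qed

lemma output_value:
  assumes \<epsilon>: "\<epsilon> > 0"
  shows "(1 / (4 * (real d + 1)) - \<epsilon>) * OPT n d b c f \<le> f (output_set f U stream (alg \<epsilon>))"
proof -
  let ?S = "output_set f U stream (alg \<epsilon>)"
  define K where "K = 1 / (4 * (real d + 1))"
  have K: "0 < K" "K \<le> 1" by (auto simp: K_def)
  obtain X where X: "X \<subseteq> {1..n}" "feasible d b c X" "f X = OPT n d b c f"
    using OPT_attained .
  have opt0: "0 \<le> f X" using nonneg[OF X(1)] .
  \<comment> \<open>For the cases where the output is no worse than the optimum: the approximation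
    factor is at most 1.\<close>
  have weaken: ?thesis if "f X \<le> f ?S"
  proof -
    have "(K - \<epsilon>) * f X \<le> 1 * f X" using K \<epsilon> opt0 by (intro mult_right_mono) auto
    then show ?thesis using that X by (simp add: K_def)
  qed
  show ?thesis
  proof (cases "max_density = 0")
    case True
    \<comment> \<open>Without guesses the output defaults to \<open>{}\<close>, which is optimal
      because nonempty feasible sets have value at most 0.\<close>
    have "guess_list \<epsilon> = []" using guess_list(1)[OF \<epsilon>] guesses_zero[OF \<epsilon>] True by simp
    then have "?S = {}" by (simp only: output_alg) simp
    moreover have "f X \<le> f {}"
    proof (cases "X = {}")
      case False
      then show ?thesis using feasible_value_le[OF X(1,2)] True nonneg[of "{}"] by simp
    qed simp
    ultimately show ?thesis using weaken by simp
  next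
    case False
    then have m: "max_density > 0" using max_density_nonneg by simp
    show ?thesis
    proof (cases "f X \<le> b * max_density")
      case True
      then obtain v where v: "v \<in> guesses b \<epsilon> max_density" "v \<le> f X" "f X \<le> v * (1 + \<epsilon>)"
        using guess_near[OF \<epsilon> m, of "f X" b] max_density_le_OPT X by auto
      have "v > 0" using guesses_pos \<epsilon> v by blast
      then obtain T where T: "T \<in> set (candidates (final_slot v))" "threshold v \<le> f T"
        using final_slot_value v X by blast
      have fS: "K * v \<le> f ?S"
        using output_ge[OF \<epsilon> v(1) T(1)] T by (simp add: threshold_def K_def)
      have "(K - \<epsilon>) * f X \<le> K * v"
      proof -
        \<comment> \<open>Rounding the optimum to \<open>v\<close> costs at most
          \<open>\<epsilon> * (K * v)\<close>, and \<open>K * v \<le> f X\<close> turns this into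
          the additive loss \<open>\<epsilon> * f X\<close>.\<close>
        have "K * f X \<le> K * (v * (1 + \<epsilon>))" using v K by (intro mult_left_mono) auto
        also have "\<dots> = K * v + \<epsilon> * (K * v)" by (simp add: algebra_simps)
        also have "\<epsilon> * (K * v) \<le> \<epsilon> * (1 * f X)"
          using \<epsilon> K v \<open>v > 0\<close> by (intro mult_left_mono mult_mono) auto
        finally show ?thesis by (simp add: algebra_simps)
      qed
      then show ?thesis using fS X by (simp add: K_def)
    next
      case False
      then have "X = {}" using feasible_value_le X by blast
      \<comment> \<open>Any guess will do here; since \<open>b \<ge> 1\<close>, rounding
        \<open>max_density\<close> itself shows that one exists.\<close>
      moreover obtain v where v: "v \<in> guesses b \<epsilon> max_density"
        using guess_near[OF \<epsilon> m, of max_density b] b m by auto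
      moreover have "f {} \<le> f (S1 (final_slot v))"
        using final_slot_value_empty guesses_pos \<epsilon> v by blast
      moreover have "f (S1 (final_slot v)) \<le> f ?S"
        by (rule output_ge[OF \<epsilon> v]) (simp add: candidates_def)
      ultimately show ?thesis using weaken by simp
    qed
  qed
qed

lemma num_passes_alg: "num_passes (alg \<epsilon>) = 1"
  by (simp add: num_passes_def passes_alg)

lemma peak_storage_alg:
  assumes \<epsilon>: "\<epsilon> > 0"
  shows "real (peak_storage f U stream (alg \<epsilon>)) \<le> space_bound (b, \<epsilon>)"
proof -
  let ?states = "{state_at f U stream (alg \<epsilon>) p k | p k. p < num_passes (alg \<epsilon>) \<and> k \<le> length stream}
        \<union> {fst (result f U stream (alg \<epsilon>))}"
  have "?states = (\<lambda>k. state_at f U stream (alg \<epsilon>) 0 k) ` {..n}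
      \<union> {fst (result f U stream (alg \<epsilon>))}"
    unfolding num_passes_alg by (auto simp del: upt_Suc)
  also have "(\<lambda>k. state_at f U stream (alg \<epsilon>) 0 k) ` {..n}
      = (\<lambda>k. map (slot_after k) (guess_list \<epsilon>)) ` {..n}"
    using state_at_alg by (intro image_cong) auto
  finally have eq: "?states = (\<lambda>k. map (slot_after k) (guess_list \<epsilon>)) ` {..n}
      \<union> {map final_slot (guess_list \<epsilon>)}"
    by (simp only: result_alg fst_conv)
  have "Max (stored (alg \<epsilon>) ` ?states) \<in> stored (alg \<epsilon>) ` ?states"
    unfolding eq by (intro Max_in) auto
  then obtain st where st: "st \<in> ?states" "Max (stored (alg \<epsilon>) ` ?states) = stored (alg \<epsilon>) st"
    by blast
  \<comment> \<open>Memory states during the scan and after \<open>finish\<close> are all images of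
    the guess list under some slot function, so one estimate serves both.\<close>
  obtain h where h: "st = map h (guess_list \<epsilon>)"
    "\<And>v. real (card (S0 (h v)) + card (S1 (h v)) + card (S2 (h v)) + card (S3 (h v))) \<le> 3 * b + 1"
    using st(1) slot_after_storage final_slot_storage unfolding eq by blast
  have "real (stored (alg \<epsilon>) st) =
      (\<Sum>v\<leftarrow>guess_list \<epsilon>. real (card (S0 (h v)) + card (S1 (h v)) + card (S2 (h v)) + card (S3 (h v))))"
    by (simp add: B2_def h comp_def sum_list_of_nat[symmetric])
  also have "\<dots> \<le> (\<Sum>v\<leftarrow>guess_list \<epsilon>. 3 * b + 1)"
    using h(2) by (intro sum_list_mono) auto
  also have "\<dots> = length (guess_list \<epsilon>) * (3 * b + 1)" by (simp add: sum_list_triv)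
  also have "\<dots> \<le> guess_bound b \<epsilon> * (3 * b + 1)"
    using guess_list[OF \<epsilon>] b by (intro mult_right_mono) auto
  finally show ?thesis unfolding peak_storage_def st(2) by (simp add: space_bound_def)
qed

lemma element_queries_alg:
  assumes \<epsilon>: "\<epsilon> > 0" and k: "k < n"
  shows "real (element_queries f U stream (alg \<epsilon>) k) \<le> query_bound (b, \<epsilon>)"
proof -
  have "element_queries f U stream (alg \<epsilon>) k =
      (\<Sum>v\<leftarrow>guess_list \<epsilon>. num_queries f U (update_slot d b c (stream ! k) (slot_after k v)))"
    using state_at_alg[of k \<epsilon>] k unfolding element_queries_def num_passes_alg
    by (simp add: passes_alg num_queries_traverse comp_def del: upt_Suc)
  also have "\<dots> \<le> (\<Sum>v\<leftarrow>guess_list \<epsilon>. 5)"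
    using num_queries_update_slot by (intro sum_list_mono) auto
  also have "\<dots> = 5 * length (guess_list \<epsilon>)" by (simp add: sum_list_triv)
  finally show ?thesis using guess_list(2)[OF \<epsilon>] by (simp add: query_bound_def)
qed

text \<open>Subroutine calls are not counted, and \<open>largest\<close> queries each of the four
  candidates of a slot once.\<close>

lemma finish_queries_alg:
  assumes \<epsilon>: "\<epsilon> > 0"
  shows "real (finish_queries f U stream (alg \<epsilon>)) \<le> query_bound (b, \<epsilon>)"
proof -
  have "finish_queries f U stream (alg \<epsilon>) = length (all_candidates \<epsilon>)"
    unfolding finish_queries_def end_state_alg finish_alg
    by (simp add: num_queries_bind run_traverse num_queries_traverse num_queries_largest
        comp_def final_slot_def[abs_def] Let_def sum_list_triv)
  then show ?thesis
    using guess_list(2)[OF \<epsilon>] by (simp only: length_all_candidates) (simp add: query_bound_def)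
qed

end

theorem theorem5:
  "\<exists>space queries :: real \<times> real \<Rightarrow> real.
     (\<forall>\<beta>>1. \<forall>\<eta>>0.
        space \<in> O[principal ({\<beta>..} \<times> {0<..\<eta>})](\<lambda>(b, \<epsilon>). b * ln b / \<epsilon>) \<and>
        queries \<in> O[principal ({\<beta>..} \<times> {0<..\<eta>})](\<lambda>(b, \<epsilon>). ln b / \<epsilon>)) \<and>
     (\<forall>(n::nat) (d::nat) (b::real) (c :: nat \<Rightarrow> nat \<Rightarrow> real) (f :: nat set \<Rightarrow> real)
        (U :: nat set \<Rightarrow> nat set) (\<epsilon>::real) (m::real).
        n \<ge> 1 \<longrightarrow> d \<ge> 1 \<longrightarrow> standardized_knapsack n d b c \<longrightarrow>
        (\<forall>S. S \<subseteq> {1..n} \<longrightarrow> f S \<ge> 0) \<longrightarrow> submodular_on {1..n} f \<longrightarrow>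
        unconstrained_half_approx {1..n} f U \<longrightarrow>
        \<epsilon> > 0 \<longrightarrow>
        m = Max {f {j} / c i j | i j. i \<in> {1..d} \<and> j \<in> {1..n}} \<longrightarrow>
        (let A = B2 d b c \<epsilon> m;
             stream = [1..<n+1];
             S = output_set f U stream A
         in S \<subseteq> {1..n} \<and> feasible d b c S \<and>
            f S \<ge> (1 / (4 * (real d + 1)) - \<epsilon>) * OPT n d b c f \<and>
            num_passes A = 1 \<and>
            real (peak_storage f U stream A) \<le> space (b, \<epsilon>) \<and>
            (\<forall>k<n. real (element_queries f U stream A k) \<le> queries (b, \<epsilon>)) \<and>
            real (finish_queries f U stream A) \<le> queries (b, \<epsilon>)))"
proof (rule exI[of _ space_bound], rule exI[of _ query_bound], intro conjI allI impI)
  \<comment> \<open>The witnesses depend only on \<open>b\<close> and \<open>\<epsilon>\<close>, so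
    the constants hidden in the bounds are uniform over all instances.\<close>
  fix \<beta> \<eta> :: real assume "\<beta> > 1" "\<eta> > 0"
  then show "space_bound \<in> O[principal ({\<beta>..} \<times> {0<..\<eta>})](\<lambda>(b, \<epsilon>). b * ln b / \<epsilon>)"
    and "query_bound \<in> O[principal ({\<beta>..} \<times> {0<..\<eta>})](\<lambda>(b, \<epsilon>). ln b / \<epsilon>)"
    by (rule bounds_bigo)+
next
  fix n d :: nat and b :: real and c :: "nat \<Rightarrow> nat \<Rightarrow> real" and f :: "nat set \<Rightarrow> real"
    and U :: "nat set \<Rightarrow> nat set" and \<epsilon> m :: real
  assume "n \<ge> 1" "d \<ge> 1" "standardized_knapsack n d b c" "\<forall>S. S \<subseteq> {1..n} \<longrightarrow> f S \<ge> 0"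
    "submodular_on {1..n} f" "unconstrained_half_approx {1..n} f U"
  then interpret knapsack n d b c f U by unfold_locales auto
  assume \<epsilon>: "\<epsilon> > 0" and m: "m = Max {f {j} / c i j | i j. i \<in> {1..d} \<and> j \<in> {1..n}}"
  show "let A = B2 d b c \<epsilon> m;
             stream = [1..<n+1];
             S = output_set f U stream A
         in S \<subseteq> {1..n} \<and> feasible d b c S \<and>
            f S \<ge> (1 / (4 * (real d + 1)) - \<epsilon>) * OPT n d b c f \<and>
            num_passes A = 1 \<and>
            real (peak_storage f U stream A) \<le> space_bound (b, \<epsilon>) \<and>
            (\<forall>k<n. real (element_queries f U stream A k) \<le> query_bound (b, \<epsilon>)) \<and>
            real (finish_queries f U stream A) \<le> query_bound (b, \<epsilon>)"
    unfolding Let_def m max_density_def[symmetric]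
    using output_feasible output_value[OF \<epsilon>] num_passes_alg peak_storage_alg[OF \<epsilon>]
      element_queries_alg[OF \<epsilon>] finish_queries_alg[OF \<epsilon>]
    by blast
qed

end
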